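(* Let $n\ge1$. For $\omega\in(0,(n+1)\pi)$ the poles $s_1,\ldots,s_n$ of the unitary best approximation $r\in\mathcal{U}_n$, $r(\mathrm{i} x)\approx \mathrm{e}^{\mathrm{i} \omega x}$, are located in the right complex plane, i.e., $\operatorname{Re} s_j>0$ for $j=1,\ldots,n$, and $$|r(z)| < 1\quad\text{for } z\in\mathbb{C} \text{ with } \operatorname{Re} z < 0.$$
   Context: For a complex polynomial $p$ let $p^\dag(z):=\overline{p}(-z)=\overline{p(-\overline z)}$, where $\overline p$ has complex-conjugated coefficients. Let $\mathcal{U}_n:=\{p^\dag/p : p \text{ a complex polynomial of degree}\le n,\ p\not\equiv 0\}$, with rational functions identified with their irreducible form; then $|r(\mathrm{i}x)|=1$ for $r\in\mathcal{U}_n$, $x\in\mathbb{R}$. For $r\in\mathcal{U}_n$, $\|r-\exp(\omega\cdot)\|:=\max_{x\in[-1,1]}|r(\mathrm{i}x)-\mathrm{e}^{\mathrm{i}\omega x}|$. For $\omega\in(0,(n+1)\pi)$ the unitary best approximation is the (existing and unique) $r\in\mathcal{U}_n$ with $\|r-\exp(\omega\cdot)\|=\min_{u\in\mathcal{U}_n}\|u-\exp(\omega\cdot)\|$; it has exactly $n$ poles. *)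

theory Defs
  imports
    "HOL-Complex_Analysis.Complex_Analysis"
    "HOL-Computational_Algebra.Field_as_Ring"
    "HOL-Computational_Algebra.Computational_Algebra"
begin

definition dag :: "complex poly \<Rightarrow> complex poly" where
  "dag p = pcompose (map_poly cnj p) [:0, -1:]"

lemma poly_dag: "poly (dag p) z = cnj (poly p (- cnj z))"
  by (simp add: dag_def poly_pcompose)

text \<open>Rational functions are elements of the fraction field of the polynomial ring, so that
  two quotients with the same irreducible form are equal.\<close>

definition unitary_rats :: "nat \<Rightarrow> complex poly fract set" where
  "unitary_rats n = {Fract (dag p) p | p. degree p \<le> n \<and> p \<noteq> 0}"

text \<open>Pointwise evaluation goes through the irreducible form \<^term>\<open>quot_of_fract r\<close>, so removable
  singularities are removed. At a pole the value is the junk value \<open>0\<close>.\<close>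

definition rat_eval :: "complex poly fract \<Rightarrow> complex \<Rightarrow> complex" where
  "rat_eval r z = poly (fst (quot_of_fract r)) z / poly (snd (quot_of_fract r)) z"

definition exp_error :: "complex poly fract \<Rightarrow> real \<Rightarrow> real" where
  "exp_error r \<omega> =
    (SUP x\<in>{-1..1::real}. cmod (rat_eval r (\<i> * of_real x) - exp (\<i> * of_real (\<omega> * x))))"

definition unitary_best_approx :: "nat \<Rightarrow> real \<Rightarrow> complex poly fract \<Rightarrow> bool" where
  "unitary_best_approx n \<omega> r \<longleftrightarrow>
    r \<in> unitary_rats n \<and> (\<forall>u\<in>unitary_rats n. exp_error r \<omega> \<le> exp_error u \<omega>)"

lemma dag_mult: "dag (p * q) = dag p * dag q"
  by (simp add: poly_eq_poly_eq_iff [symmetric] fun_eq_iff poly_dag)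

lemma dag_dag: "dag (dag p) = p"
  by (simp add: poly_eq_poly_eq_iff [symmetric] fun_eq_iff poly_dag)

lemma dag_eq_0_iff: "dag p = 0 \<longleftrightarrow> p = 0"
proof -
  have "dag 0 = 0" by (simp add: dag_def)
  then show ?thesis by (metis dag_dag)
qed

lemma unitary_rats_imaginary_axis:
  assumes "r \<in> unitary_rats n"
  shows "poly (snd (quot_of_fract r)) (\<i> * of_real x) \<noteq> 0"
    and "cmod (rat_eval r (\<i> * of_real x)) = 1"
proof -
  define a b where "a = fst (quot_of_fract r)" and "b = snd (quot_of_fract r)"
  obtain p where p: "r = Fract (dag p) p" "p \<noteq> 0"
    using assms by (auto simp: unitary_rats_def)
  have q: "quot_of_fract r = normalize_quot (dag p, p)"
    using quot_of_fract_quot_to_fract[of "(dag p, p)"] by (simp add: p quot_to_fract_def)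
  obtain d where d: "dag p = a * d" "p = b * d" "d \<noteq> 0"
    using normalize_quotE[OF p(2), of "dag p"] unfolding a_def b_def q by metis
  have "dag a * dag d = b * d" "dag b * dag d = a * d"
    using d dag_dag dag_mult by metis+
  then have "a * dag a * (d * dag d) = b * dag b * (d * dag d)"
    by (metis (no_types, lifting) mult.assoc mult.commute)
  then have ab: "a * dag a = b * dag b"
    using d(3) by (simp add: dag_eq_0_iff)
  let ?z = "\<i> * of_real x :: complex"
  have "poly a ?z * cnj (poly a ?z) = poly b ?z * cnj (poly b ?z)"
    using arg_cong[OF ab, of "\<lambda>f. poly f ?z"] by (simp add: poly_dag)
  then have eq: "cmod (poly a ?z) = cmod (poly b ?z)"
    by (metis complex_mod_sqrt_Re_mult_cnj)
  have "coprime a b"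
    unfolding a_def b_def by (simp add: q coprime_normalize_quot)
  then obtain u v where "u * a + v * b = 1"
    by (metis bezout_coefficients_fst_snd coprime_imp_gcd_eq_1)
  then have "poly u ?z * poly a ?z + poly v ?z * poly b ?z = 1"
    by (metis poly_1 poly_add poly_mult)
  then show nz: "poly (snd (quot_of_fract r)) ?z \<noteq> 0"
    using eq unfolding b_def by force
  then show "cmod (rat_eval r ?z) = 1"
    using eq by (simp add: rat_eval_def norm_divide a_def b_def)
qed

text \<open>For unitary \<open>r\<close> the supremum in \<^const>\<open>exp_error\<close> is a maximum.\<close>

lemma exp_error_attained:
  assumes "r \<in> unitary_rats n"
  obtains x where "x \<in> {-1..1}"
    "exp_error r \<omega> = cmod (rat_eval r (\<i> * of_real x) - exp (\<i> * of_real (\<omega> * x)))"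
    "\<And>y. y \<in> {-1..1} \<Longrightarrow>
      cmod (rat_eval r (\<i> * of_real y) - exp (\<i> * of_real (\<omega> * y))) \<le> exp_error r \<omega>"
proof -
  let ?f = "\<lambda>x::real. cmod (rat_eval r (\<i> * of_real x) - exp (\<i> * of_real (\<omega> * x)))"
  have "continuous_on {-1..1} ?f"
    unfolding rat_eval_def
    by (intro continuous_intros) (use unitary_rats_imaginary_axis(1)[OF assms] in auto)
  then obtain x where x: "x \<in> {-1..1}" "\<And>y. y \<in> {-1..1} \<Longrightarrow> ?f y \<le> ?f x"
    using continuous_attains_sup[of "{-1..1::real}" ?f] by auto
  have "exp_error r \<omega> = ?f x"
    unfolding exp_error_def by (rule cSup_eq_maximum) (use x in auto)
  with x that show ?thesis by metis
qed

end

theory Submission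
  imports Defs
begin

text \<open>Let \<open>r = dag b / b\<close> be the best approximation in lowest terms and \<open>N = degree b\<close>. On the imaginary
  axis \<open>r\<close> and the exponential are unimodular, and the phase error \<open>g(x)\<close> of \<open>r(\<i>x)\<close> against \<open>exp (\<i>\<omega>x)\<close> is what
  matters.

  Since \<open>\<omega> < (n+1)\<pi>\<close>, the optimal error is below \<open>2\<close> (\<open>unitary_error_less_2\<close>), so \<open>\<bar>g\<bar> < \<pi>\<close> on \<open>[-1, 1]\<close>.
  Perturbing \<open>b\<close> changes the phase, to first order and up to a factor of constant sign, by an arbitrary real
  polynomial of degree at most \<open>n + N\<close>. Optimality thus forces \<open>g\<close>, unless it vanishes identically, to alternate
  between its extreme values, and \<open>g\<close> crosses zero upwards at \<open>max 1 N\<close> points or more (\<open>best_approx_fast_contacts\<close>).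
  At these points \<open>x\<close> the function \<open>r\<close> interpolates the exponential, and its phase grows at least as fast as \<open>\<omega>x\<close>. A constant \<open>r\<close> cannot do
  this, so \<open>N \<ge> 1\<close>.

  The exponential \<open>exp (\<omega>\<cdot>)\<close> is bounded by \<open>1\<close> in the left half-plane, so its Pick matrix at boundary points is
  positive semidefinite; its off-diagonal entries depend on the boundary values and its diagonal on the phase
  derivatives. Passing from the exponential to \<open>r\<close> at the crossing points leaves the off-diagonal entries as they
  are and does not decrease the diagonal, so the Pick matrix of \<open>r\<close> is positive semidefinite, too. For
  a rational function of degree \<open>N\<close>, such a matrix of size \<open>N\<close> determines the whole kernel by interpolation, and its
  positivity says \<open>\<bar>dag b\<bar> \<le> \<bar>b\<bar>\<close> in the left half-plane (\<open>contacts_imp_dag_le\<close>). Hence \<open>b\<close> has no zero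
  there, and the maximum principle makes the inequality \<open>\<bar>r\<bar> \<le> 1\<close> strict. On the axis itself \<open>r\<close> is
  unimodular, so all poles lie in the right half-plane.\<close>

section \<open>Unitary rational functions and their error\<close>

lemma dag_smult: "dag (smult c p) = smult (cnj c) (dag p)"
  by (simp add: poly_eq_poly_eq_iff [symmetric] fun_eq_iff poly_dag)

lemma degree_dag: "degree (dag p) = degree p"
proof -
  have "degree (map_poly cnj p) = degree p"
    by (rule degree_map_poly) simp
  then show ?thesis
    by (simp add: dag_def degree_pcompose)
qed

lemma pderiv_dag: "pderiv (dag p) = - dag (pderiv p)"
proof -
  have "pderiv (map_poly cnj p) = map_poly cnj (pderiv p)"
    by (rule poly_eqI) (simp add: coeff_pderiv coeff_map_poly)
  then show ?thesis
    by (simp add: dag_def pderiv_pcompose pderiv_pCons)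
qed

lemma poly_dag_imaginary_axis: "poly (dag p) (\<i> * of_real x) = cnj (poly p (\<i> * of_real x))"
  by (simp add: poly_dag)

text \<open>Polynomials that are real on the imaginary axis, with prescribed simple zeros there; they
  realise sign patterns in the real variable \<open>x\<close> of \<open>z = \<i>x\<close>.\<close>

definition axis_prod :: "real set \<Rightarrow> complex poly" where
  "axis_prod Y = (\<Prod>y\<in>Y. [:of_real y, \<i>:])"

lemma poly_axis_prod: "poly (axis_prod Y) (\<i> * of_real x) = of_real (\<Prod>y\<in>Y. y - x)"
  by (simp add: axis_prod_def poly_prod algebra_simps flip: mult.assoc)

lemma degree_axis_prod: "finite Y \<Longrightarrow> degree (axis_prod Y) = card Y"
  by (simp add: axis_prod_def degree_prod_eq_sum_degree)

lemma rat_eval_Fract: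
  assumes "poly q z \<noteq> 0"
  shows "rat_eval (Fract p q) z = poly p z / poly q z"
proof -
  have q: "q \<noteq> 0"
    using assms by auto
  have quot: "quot_of_fract (Fract p q) = normalize_quot (p, q)"
    using quot_of_fract_quot_to_fract[of "(p, q)"] by (simp add: quot_to_fract_def)
  obtain d where d: "p = fst (quot_of_fract (Fract p q)) * d"
      "q = snd (quot_of_fract (Fract p q)) * d"
    using normalize_quotE[OF q, of p] unfolding quot by metis
  show ?thesis
    using assms arg_cong[OF d(1), of "\<lambda>f. poly f z"] arg_cong[OF d(2), of "\<lambda>f. poly f z"]
    unfolding rat_eval_def by auto
qed

text \<open>For the irreducible form \<open>a/b\<close> of \<open>r\<close>, coprimality and \<open>a \<cdot> dag a = b \<cdot> dag b\<close> give \<open>dag b = a \<cdot> e\<close>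
  with \<open>e \<cdot> dag e = 1\<close>, so \<open>e\<close> is a constant of modulus \<open>1\<close>. Scaling \<open>b\<close> by a square root of this constant
  absorbs it, so \<open>r\<close> is again of the form \<open>dag b / b\<close>, now without common factors.\<close>

lemma unitary_rats_reduced:
  assumes "r \<in> unitary_rats n"
  obtains b where "r = Fract (dag b) b" "degree b \<le> n" "coprime b (dag b)"
    "\<And>x. poly b (\<i> * of_real x) \<noteq> 0"
proof -
  define a b where "a = fst (quot_of_fract r)" and "b = snd (quot_of_fract r)"
  obtain p where p: "r = Fract (dag p) p" "p \<noteq> 0" "degree p \<le> n"
    using assms by (auto simp: unitary_rats_def)
  have q: "quot_of_fract r = normalize_quot (dag p, p)"
    using quot_of_fract_quot_to_fract[of "(dag p, p)"] by (simp add: p quot_to_fract_def)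
  obtain d where d: "dag p = a * d" "p = b * d" "d \<noteq> 0"
    using normalize_quotE[OF p(2), of "dag p"] unfolding a_def b_def q by metis
  have b0: "b \<noteq> 0"
    using d p by auto
  have "dag a * dag d = b * d" "dag b * dag d = a * d"
    using d dag_dag dag_mult by metis+
  then have "a * dag a * (d * dag d) = b * dag b * (d * dag d)"
    by (metis (no_types, lifting) mult.assoc mult.commute)
  then have ab: "a * dag a = b * dag b"
    using d(3) by (simp add: dag_eq_0_iff)
  have cop: "coprime a b"
    unfolding a_def b_def by (simp add: q coprime_normalize_quot)
  have "a dvd dag b"
    using ab cop by (metis coprime_dvd_mult_right_iff dvd_triv_left)
  then obtain e where e: "dag b = a * e" ..
  have a0: "a \<noteq> 0" and e0: "e \<noteq> 0"
    using e b0 by (auto simp: dag_eq_0_iff)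
  have "b = dag a * dag e"
    by (metis e dag_dag dag_mult)
  then have "a * dag a = dag a * dag e * (a * e)"
    using ab e by metis
  then have ee: "e * dag e = 1"
    using a0 by (simp add: dag_eq_0_iff algebra_simps)
  then have "degree e = 0"
    using degree_mult_eq[OF e0, of "dag e"] e0 by (simp add: dag_eq_0_iff degree_dag)
  then obtain c where c: "e = [:c:]"
    by (metis degree_eq_zeroE)
  have cc: "c * cnj c = 1"
    using arg_cong[OF ee, of "\<lambda>f. poly f 0"] by (simp add: c poly_dag)
  define t where "t = csqrt c"
  have tt: "t * t = c"
    unfolding t_def by (metis power2_csqrt power2_eq_square)
  have "cmod t ^ 4 = 1 ^ 4"
    using arg_cong[OF cc, of cmod] by (simp add: norm_mult power4_eq_xxxx flip: tt)
  then have "cmod t = 1"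
    by (rule power_eq_imp_eq_base) simp_all
  then have tc: "t * cnj t = 1"
    by (simp add: complex_mult_cnj cmod_def)
  then have t0: "t \<noteq> 0"
    by auto
  define B where "B = smult t b"
  have dB: "dag B = smult t a"
    using tc by (simp add: B_def dag_smult e c tt[symmetric] ac_simps flip: mult.assoc)
  have "r = Fract a b"
    unfolding a_def b_def by (metis Fract_quot_of_fract)
  also have "\<dots> = Fract (dag B) B"
    using b0 t0 unfolding dB unfolding B_def by (simp add: eq_fract)
  finally have 1: "r = Fract (dag B) B" .
  have 2: "degree B \<le> n"
    using d p(2,3) by (auto simp: B_def degree_mult_eq t0)
  have "is_unit [:t:]"
    using t0 by (simp add: is_unit_triv)
  then have "coprime ([:t:] * b) ([:t:] * a)"
    using cop by (simp only: coprime_mult_left_iff coprime_mult_right_iff is_unit_left_imp_coprime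
        is_unit_right_imp_coprime coprime_commute)
  then have 3: "coprime B (dag B)"
    unfolding dB unfolding B_def by simp
  have 4: "poly B (\<i> * of_real x) \<noteq> 0" for x
    using unitary_rats_imaginary_axis(1)[OF assms, of x] t0 by (simp add: B_def b_def)
  show ?thesis
    using that 1 2 3 4 by blast
qed

text \<open>Writing \<open>W\<close> for this function of \<open>x\<close>, one has
  \<open>dag q / q = exp (\<omega>\<cdot>) \<cdot> cnj W / W\<close> at \<open>\<i>x\<close> wherever \<open>q\<close> does not
  vanish: up to multiples of \<open>\<pi>\<close>, the argument of \<open>W\<close> is \<open>-1/2\<close> times the phase error, and the error
  depends on the direction of \<open>W\<close> alone.\<close>

definition phasor :: "complex poly \<Rightarrow> real \<Rightarrow> real \<Rightarrow> complex" where
  "phasor q \<omega> x = poly q (\<i> * of_real x) * cis (\<omega> * x / 2)"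

lemma norm_phasor: "cmod (phasor q \<omega> x) = cmod (poly q (\<i> * of_real x))"
  by (simp add: phasor_def norm_mult)

lemma error_eq_phasor:
  assumes "poly q (\<i> * of_real x) \<noteq> 0"
  shows "cmod (rat_eval (Fract (dag q) q) (\<i> * of_real x) - exp (\<i> * of_real (\<omega> * x))) =
    2 * \<bar>Im (phasor q \<omega> x)\<bar> / cmod (phasor q \<omega> x)"
proof -
  define c where "c = cis (\<omega> * x / 2)"
  define v where "v = poly q (\<i> * of_real x)"
  have cc: "c * cnj c = 1"
    by (simp add: c_def cis_cnj cis_mult)
  have c2: "exp (\<i> * of_real (\<omega> * x)) = c * c"
    unfolding c_def cis_mult cis_conv_exp by (simp add: exp_add [symmetric])
  have w: "phasor q \<omega> x = v * c"
    by (simp add: phasor_def c_def v_def)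
  have "cnj v / v - c * c = c / v * (cnj (v * c) - v * c)"
    using assms cc by (simp add: v_def field_simps)
  also have "cmod \<dots> = 2 * \<bar>Im (v * c)\<bar> / cmod (v * c)"
  proof -
    have "cmod (cnj z - z) = 2 * \<bar>Im z\<bar>" for z
      by (simp add: norm_minus_commute complex_diff_cnj norm_mult del: complex_cnj_diff)
    then show ?thesis
      by (simp add: norm_mult norm_divide c_def del: complex_cnj_mult)
  qed
  finally show ?thesis
    unfolding c2 w rat_eval_Fract[OF assms] poly_dag_imaginary_axis v_def [symmetric] .
qed

lemma exp_error_less:
  assumes "degree q \<le> n" "0 \<le> \<sigma>"
    and "\<And>x. x \<in> {-1..1} \<Longrightarrow> (Im (phasor q \<omega> x))\<^sup>2 < \<sigma>\<^sup>2 * (cmod (phasor q \<omega> x))\<^sup>2"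
  shows "Fract (dag q) q \<in> unitary_rats n" "exp_error (Fract (dag q) q) \<omega> < 2 * \<sigma>"
proof -
  have nz: "poly q (\<i> * of_real x) \<noteq> 0" if "x \<in> {-1..1}" for x
    using assms(3)[OF that] by (auto simp: phasor_def)
  have "q \<noteq> 0"
    using nz[of 0] by auto
  then show mem: "Fract (dag q) q \<in> unitary_rats n"
    using assms(1) by (auto simp: unitary_rats_def)
  obtain x where x: "x \<in> {-1..1}" "exp_error (Fract (dag q) q) \<omega> =
      cmod (rat_eval (Fract (dag q) q) (\<i> * of_real x) - exp (\<i> * of_real (\<omega> * x)))"
    using exp_error_attained[OF mem] by metis
  have "\<bar>Im (phasor q \<omega> x)\<bar> < \<sigma> * cmod (phasor q \<omega> x)"
    using assms(3)[OF x(1)] assms(2)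
    by (metis mult_nonneg_nonneg norm_ge_zero power2_less_imp_less power_mult_distrib power2_abs)
  moreover have "cmod (phasor q \<omega> x) > 0"
    using nz[OF x(1)] by (simp add: norm_phasor)
  ultimately show "exp_error (Fract (dag q) q) \<omega> < 2 * \<sigma>"
    unfolding x(2) error_eq_phasor[OF nz[OF x(1)]] by (simp add: field_simps)
qed

section \<open>An approximation with error below 2\<close>

text \<open>Both factors change sign exactly at the points \<open>\<pi>, 2\<pi>, \<dots>, n\<pi>\<close>; the induction step shifts by \<open>\<pi>\<close>.\<close>

lemma sin_prod_pos:
  assumes "0 < \<psi>" "\<psi> < (real n + 1) * pi" "\<And>j. j \<in> {1..n} \<Longrightarrow> \<psi> \<noteq> real j * pi"
  shows "0 < sin \<psi> * (\<Prod>j=1..n. real j * pi - \<psi>)"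
  using assms
proof (induction n arbitrary: \<psi>)
  case 0
  then show ?case
    by (simp add: sin_gt_zero)
next
  case (Suc n)
  show ?case
  proof (cases "\<psi> < pi")
    case True
    have "\<psi> < real j * pi" if "j \<in> {1..Suc n}" for j
    proof -
      have "1 * pi \<le> real j * pi"
        using that by (intro mult_right_mono; simp)
      with True show ?thesis
        by linarith
    qed
    then have "(\<Prod>j=1..Suc n. real j * pi - \<psi>) > 0"
      by (intro prod_pos) auto
    then show ?thesis
      using True Suc.prems(1) by (simp add: sin_gt_zero)
  next
    case False
    define \<phi> where "\<phi> = \<psi> - pi"
    have "\<psi> \<noteq> pi"
      using Suc.prems(3)[of 1] by simp
    then have pos: "0 < \<phi>"
      using False by (simp add: \<phi>_def)
    have "(\<Prod>j=1..Suc n. real j * pi - \<psi>) = (pi - \<psi>) * (\<Prod>j=1..n. real (Suc j) * pi - \<psi>)"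
      unfolding One_nat_def
      by (subst prod.atLeast_Suc_atMost, simp, subst prod.atLeast_Suc_atMost_Suc_shift) simp
    also have "\<dots> = - \<phi> * (\<Prod>j=1..n. real j * pi - \<phi>)"
      by (simp add: \<phi>_def algebra_simps)
    finally have eq: "(\<Prod>j=1..Suc n. real j * pi - \<psi>) = - \<phi> * (\<Prod>j=1..n. real j * pi - \<phi>)" .
    have "sin \<psi> = - sin \<phi>"
      by (simp add: \<phi>_def)
    then have "sin \<psi> * (\<Prod>j=1..Suc n. real j * pi - \<psi>) =
        \<phi> * (sin \<phi> * (\<Prod>j=1..n. real j * pi - \<phi>))"
      unfolding eq by simp
    moreover have "0 < sin \<phi> * (\<Prod>j=1..n. real j * pi - \<phi>)"
    proof (rule Suc.IH[OF pos])
      show "\<phi> < (real n + 1) * pi"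
        using Suc.prems(2) by (simp add: \<phi>_def algebra_simps)
      show "\<phi> \<noteq> real j * pi" if "j \<in> {1..n}" for j
        using Suc.prems(3)[of "Suc j"] that by (auto simp: \<phi>_def algebra_simps)
    qed
    ultimately show ?thesis
      using pos by simp
  qed
qed

text \<open>The only points at which \<open>G0\<close> gives no room are its zeros, and there the linear term is
  positive. The quadratic term is harmless: if every small \<open>t\<close> failed somewhere in \<open>K\<close>, the failing points
  would accumulate at a zero of \<open>G0\<close> with \<open>G1 \<le> 0\<close>.\<close>

lemma positive_perturbation:
  fixes G0 G1 G2 :: "real \<Rightarrow> real"
  assumes "compact K" and cont: "continuous_on K G0" "continuous_on K G1" "continuous_on K G2"
    and nonneg: "\<And>x. x \<in> K \<Longrightarrow> 0 \<le> G0 x"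
    and deriv: "\<And>x. x \<in> K \<Longrightarrow> G0 x = 0 \<Longrightarrow> 0 < G1 x"
  obtains t where "0 < t" "\<And>x. x \<in> K \<Longrightarrow> 0 < G0 x + t * G1 x + t\<^sup>2 * G2 x"
proof -
  define t where "t m = 1 / real (Suc m)" for m
  have t: "0 < t m" for m
    by (simp add: t_def)
  have "\<exists>m. \<forall>x\<in>K. 0 < G0 x + t m * G1 x + (t m)\<^sup>2 * G2 x"
  proof (rule ccontr)
    assume "\<not> ?thesis"
    then have "\<forall>m. \<exists>x\<in>K. G0 x + t m * G1 x + (t m)\<^sup>2 * G2 x \<le> 0"
      by (meson not_less)
    then obtain X where X: "\<And>m. X m \<in> K"
        "\<And>m. G0 (X m) + t m * G1 (X m) + (t m)\<^sup>2 * G2 (X m) \<le> 0"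
      by metis
    obtain x s where x: "x \<in> K" "strict_mono s" "(X \<circ> s) \<longlonglongrightarrow> x"
      using assms(1) X(1) unfolding compact_def by meson
    have lim: "(\<lambda>m. G (X (s m))) \<longlonglongrightarrow> G x" if "continuous_on K G" for G :: "real \<Rightarrow> real"
      using continuous_on_tendsto_compose[OF that x(3)[unfolded o_def] x(1)] X(1) by simp
    have "t \<longlonglongrightarrow> 0"
      unfolding t_def by (rule LIMSEQ_inverse_real_of_nat[unfolded inverse_eq_divide])
    then have ts: "(\<lambda>m. t (s m)) \<longlonglongrightarrow> 0"
      using LIMSEQ_subseq_LIMSEQ[OF _ x(2), of t 0] by (simp add: o_def)
    have "(\<lambda>m. G0 (X (s m)) + t (s m) * G1 (X (s m)) + (t (s m))\<^sup>2 * G2 (X (s m)))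
        \<longlonglongrightarrow> G0 x + 0 * G1 x + 0\<^sup>2 * G2 x"
      by (intro tendsto_intros lim cont ts)
    then have "G0 x \<le> 0"
      using X(2) by (intro LIMSEQ_le_const2) auto
    then have "0 < G1 x"
      using nonneg[OF x(1)] deriv[OF x(1)] by simp
    moreover have "G1 (X (s m)) + t (s m) * G2 (X (s m)) \<le> 0" for m
    proof -
      have "t (s m) * (G1 (X (s m)) + t (s m) * G2 (X (s m))) \<le> 0"
        using X(2)[of "s m"] nonneg[OF X(1)[of "s m"]] by (simp add: algebra_simps power2_eq_square)
      then show ?thesis
        using t[of "s m"] by (simp add: mult_le_0_iff)
    qed
    moreover have "(\<lambda>m. G1 (X (s m)) + t (s m) * G2 (X (s m))) \<longlonglongrightarrow> G1 x + 0 * G2 x"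
      by (intro tendsto_intros lim cont ts)
    ultimately show False
      using LIMSEQ_le_const2[of _ "G1 x + 0 * G2 x" 0] by force
  qed
  then show ?thesis
    using that t by blast
qed

text \<open>An error below \<open>2\<close> means that the phasor \<open>W\<close> is never purely imaginary, which
  is the case if its real part is positive. With \<open>\<psi>(x) = \<omega>x/2 + (n+1)\<pi>/2\<close>, the assumption \<open>\<omega> < (n+1)\<pi>\<close> keeps \<open>\<psi>\<close> inside
  \<open>(0, (n+1)\<pi>)\<close>, where \<open>sin \<psi>\<close> has only \<open>n\<close> zeros. A real polynomial \<open>A\<close> of degree \<open>n\<close> with the same zeros
  makes \<open>A sin \<psi>\<close> nonnegative, and a small multiple of \<open>- B cos \<psi>\<close>, with \<open>B\<close> vanishing at the \<open>n - 1\<close> inner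
  zeros of \<open>cos \<psi>\<close>, makes it positive at the zeros as well. Any pair of real polynomials of degree at most \<open>n\<close>
  is the pair of real and imaginary parts of a denominator on the axis.\<close>

lemma unitary_error_less_2:
  assumes "n \<ge> 1" "0 < \<omega>" "\<omega> < (real n + 1) * pi"
  obtains u where "u \<in> unitary_rats n" "exp_error u \<omega> < 2"
proof -
  define \<psi> where "\<psi> x = \<omega> * x / 2 + (real n + 1) * pi / 2" for x
  define Y where "Y k c = (\<lambda>j. (2 * (real j * pi + c) - (real n + 1) * pi) / \<omega>) ` {1..k}"
    for k :: nat and c :: real
  \<comment> \<open>The points of \<open>Y k c\<close> are those with \<open>\<psi>(y) = j\<pi> + c\<close>: zeros of \<open>sin \<psi>\<close> for \<open>c = 0\<close>, of \<open>cos \<psi>\<close> for \<open>c = \<pi>/2\<close>.\<close>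
  have prod_Y: "(\<Prod>y\<in>Y k c. y - x) = (2 / \<omega>) ^ k * (\<Prod>j=1..k. real j * pi - (\<psi> x - c))"
    for k c x
  proof -
    have "inj_on (\<lambda>j. (2 * (real j * pi + c) - (real n + 1) * pi) / \<omega>) {1..k}"
      using assms(2) by (auto simp: inj_on_def)
    then have "(\<Prod>y\<in>Y k c. y - x) = (\<Prod>j=1..k. 2 / \<omega> * (real j * pi - (\<psi> x - c)))"
      unfolding Y_def using assms(2)
      by (subst prod.reindex) (auto intro!: prod.cong simp: \<psi>_def field_simps)
    then show ?thesis
      by (simp only: prod.distrib prod_constant card_atLeastAtMost) simp
  qed
  define A where "A x = (\<Prod>y\<in>Y n 0. y - x)" for x
  define B where "B x = (\<Prod>y\<in>Y (n - 1) (pi / 2). y - x)" for x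
  have \<psi>: "0 < \<psi> x" "\<psi> x < (real n + 1) * pi" if "x \<in> {-1..1}" for x
  proof -
    have "\<bar>\<omega> * x\<bar> \<le> \<omega> * 1"
      unfolding abs_mult using assms(2) that by (intro mult_mono) auto
    with assms(3) show "0 < \<psi> x" "\<psi> x < (real n + 1) * pi"
      by (auto simp: \<psi>_def abs_le_iff)
  qed
  have sinA: "0 \<le> sin (\<psi> x) * A x" "sin (\<psi> x) * A x = 0 \<Longrightarrow> 0 < - cos (\<psi> x) * B x"
    if x: "x \<in> {-1..1}" for x
  proof -
    consider k where "k \<in> {1..n}" "\<psi> x = real k * pi" | "\<And>j. j \<in> {1..n} \<Longrightarrow> \<psi> x \<noteq> real j * pi"
      by blast
    then have "sin (\<psi> x) * A x = 0 \<and> 0 < - cos (\<psi> x) * B x \<or> 0 < sin (\<psi> x) * A x"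
    proof cases
      case (1 k)
      \<comment> \<open>The sign of \<open>- B cos \<psi>\<close> is again an instance of \<open>sin_prod_pos\<close>, after a shift by \<open>\<pi>/2\<close>.\<close>
      have "0 < sin (\<psi> x - pi / 2) * (\<Prod>j=1..n - 1. real j * pi - (\<psi> x - pi / 2))"
      proof (rule sin_prod_pos)
        have "1 * pi \<le> real k * pi" "real k * pi \<le> real n * pi"
          using 1 by (auto intro!: mult_right_mono)
        moreover have n: "real (n - 1) + 1 = real n"
          using assms(1) by simp
        ultimately show "0 < \<psi> x - pi / 2" "\<psi> x - pi / 2 < (real (n - 1) + 1) * pi"
          using pi_gt_zero unfolding 1(2) n by linarith+
        show "\<psi> x - pi / 2 \<noteq> real j * pi" for j
        proof
          assume "\<psi> x - pi / 2 = real j * pi"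
          then have "(real k - 1 / 2 - real j) * pi = 0"
            using 1 by (simp add: algebra_simps)
          then have "real (2 * k) = real (2 * j + 1)"
            by simp
          then show False
            unfolding of_nat_eq_iff by presburger
        qed
      qed
      moreover have "sin (\<psi> x - pi / 2) = - cos (\<psi> x)"
        by (simp add: sin_diff)
      ultimately have "0 < - cos (\<psi> x) * (\<Prod>j=1..n - 1. real j * pi - (\<psi> x - pi / 2))"
        by simp
      then have "0 < (2 / \<omega>) ^ (n - 1) *
          (- cos (\<psi> x) * (\<Prod>j=1..n - 1. real j * pi - (\<psi> x - pi / 2)))"
        using assms(2) by (simp only: mult_pos_pos zero_less_power divide_pos_pos zero_less_numeral)
      then have "0 < - cos (\<psi> x) * B x"
        unfolding B_def prod_Y by (simp only: mult.left_commute)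
      moreover have "sin (\<psi> x) = 0"
        using 1 by simp
      ultimately show ?thesis
        by simp
    next
      case 2
      have "0 < (2 / \<omega>) ^ n * (sin (\<psi> x) * (\<Prod>j=1..n. real j * pi - \<psi> x))"
        using assms(2) by (intro mult_pos_pos sin_prod_pos \<psi> x 2) auto
      then have "0 < sin (\<psi> x) * A x"
        unfolding A_def prod_Y by (simp only: mult.left_commute diff_zero)
      then show ?thesis
        by simp
    qed
    then show "0 \<le> sin (\<psi> x) * A x" "sin (\<psi> x) * A x = 0 \<Longrightarrow> 0 < - cos (\<psi> x) * B x"
      by auto
  qed
  obtain t where t: "0 < t"
    "\<And>x. x \<in> {-1..1} \<Longrightarrow> 0 < sin (\<psi> x) * A x + t * (- cos (\<psi> x) * B x) + t\<^sup>2 * 0"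
  proof (rule positive_perturbation[of "{-1..1}" "\<lambda>x. sin (\<psi> x) * A x" "\<lambda>x. - cos (\<psi> x) * B x" "\<lambda>_. 0"])
    show "continuous_on {- 1..1} (\<lambda>x. sin (\<psi> x) * A x)"
      "continuous_on {- 1..1} (\<lambda>x. - cos (\<psi> x) * B x)"
      unfolding \<psi>_def A_def B_def by (intro continuous_intros; simp)+
  qed (use sinA in auto)
  define q where "q = smult (cis ((real n + 1) * pi / 2))
    (smult (- of_real t) (axis_prod (Y (n - 1) (pi / 2))) - smult \<i> (axis_prod (Y n 0)))"
  have Ycard: "finite (Y k c)" "card (Y k c) \<le> k" for k c
    unfolding Y_def using card_image_le[of "{1..k}"] by auto
  have deg: "degree q \<le> n"
    unfolding q_def
    by (intro order.trans[OF degree_smult_le] degree_diff_le order.trans[OF degree_axis_prod[THEN eq_refl]]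
        order.trans[OF Ycard(2)] Ycard(1)) auto
  have Re_pos: "0 < Re (phasor q \<omega> x)" if x: "x \<in> {-1..1}" for x
  proof -
    have "phasor q \<omega> x = cis (\<psi> x) * (of_real (- t * B x) - \<i> * of_real (A x))"
      by (simp add: phasor_def q_def poly_axis_prod A_def B_def \<psi>_def add.commute flip: cis_mult)
    then have "Re (phasor q \<omega> x) = sin (\<psi> x) * A x + t * (- cos (\<psi> x) * B x)"
      by simp
    with t(2)[OF x] show ?thesis
      by simp
  qed
  have "(Im (phasor q \<omega> x))\<^sup>2 < 1\<^sup>2 * (cmod (phasor q \<omega> x))\<^sup>2" if "x \<in> {-1..1}" for x
    using Re_pos[OF that] by (simp add: cmod_power2)
  from exp_error_less[OF deg zero_le_one this] show ?thesis
    using that by simp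
qed

section \<open>Upward crossings or a separating polynomial\<close>

text \<open>Room for a sign change just to the left of the next point of the opposite type.\<close>

lemma closed_avoids_left:
  fixes A :: "real set"
  assumes "closed A" "b \<notin> A" "l < b"
  obtains y where "l < y" "y < b" "\<And>x. x \<in> A \<Longrightarrow> \<not> (y \<le> x \<and> x \<le> b)"
proof -
  obtain e where e: "0 < e" "ball b e \<subseteq> - A"
    using assms(1,2) by (meson ComplI openE open_Compl)
  define d where "d = min e (b - l)"
  have d: "0 < d" "d \<le> e" "d \<le> b - l"
    using e(1) assms(3) by (auto simp: d_def)
  define y where "y = b - d / 2"
  show ?thesis
  proof (rule that[of y])
    show "l < y" "y < b"
      using d by (auto simp: y_def)
    show "\<not> (y \<le> x \<and> x \<le> b)" if "x \<in> A" for x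
    proof
      assume "y \<le> x \<and> x \<le> b"
      then have "x \<in> ball b e"
        using d by (auto simp: y_def dist_real_def)
      with e(2) that show False
        by auto
    qed
  qed
qed

text \<open>The combinatorial half of the alternation argument. Read \<open>A\<close> and \<open>B\<close> as the places of
  maximal positive and negative phase error. Scanning from the left, every passage from \<open>B\<close> to \<open>A\<close> costs
  two sign changes of a separating product and yields one upward crossing. Hence either \<open>M\<close> crossings are found, or
  fewer than \<open>2M\<close> sign changes separate \<open>A\<close> from \<open>B\<close>. The bound \<open>l\<close> keeps the crossings and zeros produced
  by the recursion to the right of the ones already placed.\<close>

lemma crossings_or_separating_product:
  fixes A B :: "real set" and P :: "real \<Rightarrow> bool"
  assumes "closed A" "closed B" "A \<inter> B = {}" "A \<subseteq> {l<..}" "B \<subseteq> {l<..}"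
    and crossing: "\<And>b a. b \<in> B \<Longrightarrow> a \<in> A \<Longrightarrow> b < a \<Longrightarrow> \<exists>c. b < c \<and> c < a \<and> P c"
  shows "(\<exists>X. finite X \<and> card X = M \<and> X \<subseteq> {l<..} \<and> (\<forall>c\<in>X. P c)) \<or>
    (\<exists>Y. finite Y \<and> card Y < 2 * M \<and> Y \<subseteq> {l<..} \<and>
      (\<forall>x\<in>A. 0 < (\<Prod>y\<in>Y. y - x)) \<and> (\<forall>x\<in>B. (\<Prod>y\<in>Y. y - x) < 0))"
  using assms
proof (induction M arbitrary: A B l)
  case 0
  then show ?case
    by (intro disjI1 exI[of _ "{}"]) auto
next
  case (Suc M)
  show ?case
  proof (cases "B = {}")
    case True
    then show ?thesis
      by (intro disjI2 exI[of _ "{}"]) auto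
  next
    case False
    define b where "b = Inf B"
    have bdd: "bdd_below B"
      using Suc.prems(5) by (meson bdd_below.I2 bdd_below_Ioi bdd_below_mono)
    have b: "b \<in> B" "\<And>x. x \<in> B \<Longrightarrow> b \<le> x"
      unfolding b_def using closed_contains_Inf[OF False bdd Suc.prems(2)] cInf_lower[OF _ bdd] by auto
    have "b \<notin> A" "l < b"
      using b(1) Suc.prems(3,5) by auto
    then obtain y1 where y1: "l < y1" "y1 < b" "\<And>x. x \<in> A \<Longrightarrow> \<not> (y1 \<le> x \<and> x \<le> b)"
      using closed_avoids_left[OF Suc.prems(1)] by metis
    define A1 where "A1 = A \<inter> {b..}"
    have A1: "closed A1" "bdd_below A1"
      unfolding A1_def using Suc.prems(1) by (auto intro: closed_Int)
    show ?thesis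
    proof (cases "A1 = {}")
      case True
      have "\<forall>x\<in>A. x < y1"
        using True y1(3) by (force simp: A1_def not_le)
      moreover have "\<forall>x\<in>B. y1 < x"
        using b(2) y1(2) by force
      ultimately show ?thesis
        using y1(1) by (intro disjI2 exI[of _ "{y1}"]) auto
    next
      case False
      define a where "a = Inf A1"
      have "a \<in> A1" and a_le: "\<And>x. x \<in> A1 \<Longrightarrow> a \<le> x"
        unfolding a_def using closed_contains_Inf[OF False A1(2,1)] cInf_lower[OF _ A1(2)] by auto
      then have a: "a \<in> A" "b < a"
        using \<open>b \<notin> A\<close> by (cases "a = b"; auto simp: A1_def)+
      obtain c where c: "b < c" "c < a" "P c"
        using Suc.prems(6)[OF b(1) a] by blast
      have "a \<notin> B"
        using a(1) Suc.prems(3) by auto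
      then obtain y2 where y2: "c < y2" "y2 < a" "\<And>x. x \<in> B \<Longrightarrow> \<not> (y2 \<le> x \<and> x \<le> a)"
        using closed_avoids_left[OF Suc.prems(2) _ c(2)] by metis
      define A' where "A' = A \<inter> {a..}"
      define B' where "B' = B \<inter> {a..}"
      have A_cases: "x \<in> A' \<or> x < y1" if "x \<in> A" for x
        using that y1(3)[of x] a_le[of x] by (auto simp: A'_def A1_def)
      have B_cases: "x \<in> B' \<or> b \<le> x \<and> x < y2" if "x \<in> B" for x
        using that y2(3)[of x] b(2)[of x] by (auto simp: B'_def)
      have "(\<exists>X. finite X \<and> card X = M \<and> X \<subseteq> {y2<..} \<and> (\<forall>c\<in>X. P c)) \<or>
        (\<exists>Y. finite Y \<and> card Y < 2 * M \<and> Y \<subseteq> {y2<..} \<and>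
          (\<forall>x\<in>A'. 0 < (\<Prod>y\<in>Y. y - x)) \<and> (\<forall>x\<in>B'. (\<Prod>y\<in>Y. y - x) < 0))"
      proof (rule Suc.IH)
        show "\<exists>c. b < c \<and> c < a \<and> P c" if "b \<in> B'" "a \<in> A'" "b < a" for b a
          using Suc.prems(6) that by (simp add: A'_def B'_def)
      qed (use Suc.prems(1-3) y2(2) in \<open>auto simp: A'_def B'_def intro!: closed_Int\<close>)
      then show ?thesis
      proof (elim disjE exE conjE)
        fix X
        assume X: "finite X" "card X = M" "X \<subseteq> {y2<..}" "\<forall>c\<in>X. P c"
        have "c \<notin> X" "\<forall>x\<in>X. l < x"
          using X(3) y2(1) y1 c(1) by fastforce+
        then show ?thesis
          using X y1 c by (intro disjI1 exI[of _ "insert c X"]) auto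
      next
        fix Y
        assume Y: "finite Y" "card Y < 2 * M" "Y \<subseteq> {y2<..}"
          "\<forall>x\<in>A'. 0 < (\<Prod>y\<in>Y. y - x)" "\<forall>x\<in>B'. (\<Prod>y\<in>Y. y - x) < 0"
        have order: "l < y1" "y1 < b" "b < y2" "y2 < a"
          using y1 c(1) y2 by auto
        have notin: "y1 \<notin> insert y2 Y" "y2 \<notin> Y"
          using Y(3) order by auto
        have prod: "(\<Prod>y\<in>insert y1 (insert y2 Y). y - x) = (y1 - x) * ((y2 - x) * (\<Prod>y\<in>Y. y - x))" for x
          using Y(1) notin by simp
        have Ypos: "0 < (\<Prod>y\<in>Y. y - x)" if "x < y2" for x
          using that Y(3) by (intro prod_pos) force
        have "0 < (\<Prod>y\<in>insert y1 (insert y2 Y). y - x)" if "x \<in> A" for x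
          using A_cases[OF that]
        proof
          assume "x \<in> A'"
          then have "y1 - x < 0" "y2 - x < 0" "0 < (\<Prod>y\<in>Y. y - x)"
            using order Y(4) by (auto simp: A'_def)
          then show ?thesis
            unfolding prod by (simp add: zero_less_mult_iff mult_less_0_iff)
        next
          assume "x < y1"
          then show ?thesis
            unfolding prod using order Ypos[of x] by simp
        qed
        moreover have "(\<Prod>y\<in>insert y1 (insert y2 Y). y - x) < 0" if "x \<in> B" for x
          using B_cases[OF that]
        proof
          assume "x \<in> B'"
          then have "y1 - x < 0" "y2 - x < 0" "(\<Prod>y\<in>Y. y - x) < 0"
            using order Y(5) by (auto simp: B'_def)
          then show ?thesis
            unfolding prod by (simp add: zero_less_mult_iff mult_less_0_iff)
        next
          assume "b \<le> x \<and> x < y2"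
          then show ?thesis
            unfolding prod using order Ypos[of x] by (simp add: mult_less_0_iff)
        qed
        moreover have "card (insert y1 (insert y2 Y)) < 2 * Suc M"
          using Y(1,2) notin by simp
        moreover have "insert y1 (insert y2 Y) \<subseteq> {l<..}"
          using Y(3) order by auto
        ultimately show ?thesis
          using Y(1) by (intro disjI2 exI[of _ "insert y1 (insert y2 Y)"]) auto
      qed
    qed
  qed
qed

text \<open>The last zero before \<open>a\<close> after which the function stays positive has nonnegative slope.\<close>

lemma upward_crossing:
  fixes V :: "real \<Rightarrow> real"
  assumes "b < a" "V b < 0" "0 < V a" and deriv: "\<And>x. (V has_real_derivative V' x) (at x)"
  obtains c where "b < c" "c < a" "V c = 0" "0 \<le> V' c"
proof -
  have cont: "continuous_on S V" for S
    using deriv by (meson DERIV_isCont continuous_at_imp_continuous_on)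
  define S where "S = {x \<in> {b..a}. V x \<le> 0}"
  define c where "c = Sup S"
  have "closed S"
    using continuous_closed_preimage[OF cont closed_atLeastAtMost closed_atMost, of b a 0]
    by (simp add: S_def vimage_def Int_def conj_commute)
  have "b \<in> S"
    using assms by (simp add: S_def)
  have bdd: "bdd_above S"
    by (auto simp: S_def)
  have "c \<in> S"
    unfolding c_def using closed_contains_Sup[OF _ bdd \<open>closed S\<close>] \<open>b \<in> S\<close> by auto
  then have c: "b \<le> c" "c \<le> a" "V c \<le> 0"
    by (auto simp: S_def)
  moreover have "c \<noteq> a"
    using c(3) assms(3) by auto
  ultimately have c: "b \<le> c" "c < a" "V c \<le> 0"
    by auto
  have right: "0 < V x" if "c < x" "x \<le> a" for x
  proof (rule ccontr)
    assume "\<not> 0 < V x"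
    then have "x \<in> S"
      using that c by (simp add: S_def)
    then have "x \<le> c"
      unfolding c_def using bdd by (rule cSup_upper)
    with that show False
      by simp
  qed
  have "V c = 0"
  proof (rule ccontr)
    assume "V c \<noteq> 0"
    then obtain x where "c \<le> x" "x \<le> a" "V x = 0"
      using IVT'[of V c 0 a] c assms(3) cont by auto
    with right[of x] \<open>V c \<noteq> 0\<close> show False
      by (cases "x = c") auto
  qed
  moreover have "0 \<le> V' c"
  proof (rule ccontr)
    assume "\<not> 0 \<le> V' c"
    then obtain d where d: "0 < d" "\<And>h. 0 < h \<Longrightarrow> h < d \<Longrightarrow> V (c + h) < V c"
      using DERIV_neg_dec_right[OF deriv, of c] by auto
    obtain h where "0 < h" "h < min d (a - c)"
      using d(1) c(2) dense[of 0 "min d (a - c)"] by auto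
    then have "0 < h" "h < d" "c + h \<le> a"
      by auto
    then show False
      using d(2)[of h] right[of "c + h"] \<open>V c = 0\<close> by simp
  qed
  moreover have "b \<noteq> c"
    using assms(2) \<open>V c = 0\<close> by auto
  ultimately show ?thesis
    using that[of c] c(1,2) by simp
qed

section \<open>The variational argument\<close>

text \<open>First-order phase changes of \<open>dag b / b\<close> under \<open>b + t h\<close> are governed by the imaginary part
  of \<open>h \<cdot> cnj b\<close> on the axis, and by Bezout every real polynomial of degree up to \<open>n + degree b\<close> is such an
  imaginary part: solve \<open>u \<cdot> dag b + v \<cdot> b = 2\<i>f\<close> with \<open>u\<close> reduced modulo \<open>b\<close>, which bounds the degree
  of \<open>v\<close>, and symmetrise to \<open>h = (u - dag v)/2\<close>.\<close>

lemma bezout_imaginary_part: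
  assumes cop: "coprime b (dag b)" and deg: "degree b \<le> n" and f: "degree f \<le> n + degree b"
  obtains h where "degree h \<le> n"
    "\<And>x. Im (poly h (\<i> * of_real x) * cnj (poly b (\<i> * of_real x))) = Re (poly f (\<i> * of_real x))"
proof -
  define F where "F = smult (2 * \<i>) f"
  obtain u0 v0 where "u0 * dag b + v0 * b = 1"
    using cop by (metis bezout_coefficients_fst_snd coprime_imp_gcd_eq_1 coprime_commute)
  then have uv0: "(u0 * F) * dag b + (v0 * F) * b = F"
    by (metis (no_types, lifting) distrib_right mult.assoc mult.commute mult_1)
  define k where "k = (u0 * F) div b"
  define u where "u = (u0 * F) mod b"
  define v where "v = v0 * F + k * dag b"
  have "k * b + u = u0 * F"
    by (simp add: k_def u_def)
  moreover have "u * dag b + v * b = (k * b + u) * dag b + (v0 * F) * b"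
    by (simp add: v_def algebra_simps)
  ultimately have uv: "u * dag b + v * b = F"
    using uv0 by simp
  have b0: "b \<noteq> 0"
    using cop by (auto simp: dag_def)
  have du: "degree u \<le> degree b"
    unfolding u_def using degree_mod_less[OF b0, of "u0 * F"] by auto
  have dv: "degree v \<le> n"
  proof (cases "v = 0")
    case False
    have "degree v + degree b = degree (v * b)"
      using False b0 by (simp add: degree_mult_eq)
    also have "v * b = F - u * dag b"
      using uv by (simp add: algebra_simps)
    also have "degree (F - u * dag b) \<le> n + degree b"
    proof (rule degree_diff_le)
      show "degree F \<le> n + degree b"
        using f by (simp add: F_def)
      show "degree (u * dag b) \<le> n + degree b"
        using degree_mult_le[of u "dag b"] du deg by (simp add: degree_dag)
    qed
    finally show ?thesis
      by simp
  qed simp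
  define h where "h = smult (1 / 2) (u - dag v)"
  have "degree h \<le> n"
    unfolding h_def using du dv deg
    by (intro order.trans[OF degree_smult_le] degree_diff_le) (auto simp: degree_dag)
  moreover have "Im (poly h z * cnj (poly b z)) = Re (poly f z)" if z: "z = \<i> * of_real x" for z x
  proof -
    have "poly u z * cnj (poly b z) + poly v z * poly b z = 2 * \<i> * poly f z"
      using arg_cong[OF uv, of "\<lambda>p. poly p z"] by (simp add: z poly_dag_imaginary_axis F_def)
    moreover have "poly h z * cnj (poly b z) = (poly u z * cnj (poly b z) - cnj (poly v z * poly b z)) / 2"
      by (simp add: h_def z poly_dag_imaginary_axis algebra_simps)
    then have "Im (poly h z * cnj (poly b z)) = Im (poly u z * cnj (poly b z) + poly v z * poly b z) / 2"
      by (simp only: Im_divide_numeral minus_complex.sel plus_complex.sel complex_cnj) simp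
    ultimately show ?thesis
      by simp
  qed
  ultimately show ?thesis
    using that by blast
qed

text \<open>Kolmogorov's criterion: if some admissible \<open>f\<close> has the sign of the phase error wherever the
  error attains its bound, then a small step in the corresponding direction \<open>h\<close> decreases the error on all
  of \<open>[-1, 1]\<close>. The condition on the perturbed phasor is quadratic in the step size \<open>t\<close>.\<close>

lemma improve_if_separated:
  assumes cop: "coprime b (dag b)" and deg: "degree b \<le> n"
    and f: "degree f \<le> n + degree b"
    and err: "\<And>x. x \<in> {-1..1} \<Longrightarrow> (Im (phasor b \<omega> x))\<^sup>2 \<le> \<sigma>\<^sup>2 * (cmod (phasor b \<omega> x))\<^sup>2"
    and sep: "\<And>x. x \<in> {-1..1} \<Longrightarrow> (Im (phasor b \<omega> x))\<^sup>2 = \<sigma>\<^sup>2 * (cmod (phasor b \<omega> x))\<^sup>2 \<Longrightarrow>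
      Re (phasor b \<omega> x) * Im (phasor b \<omega> x) * Re (poly f (\<i> * of_real x)) < 0"
  obtains q where "degree q \<le> n"
    "\<And>x. x \<in> {-1..1} \<Longrightarrow> (Im (phasor q \<omega> x))\<^sup>2 < \<sigma>\<^sup>2 * (cmod (phasor q \<omega> x))\<^sup>2"
proof -
  obtain h where h: "degree h \<le> n"
    "\<And>x. Im (poly h (\<i> * of_real x) * cnj (poly b (\<i> * of_real x))) = Re (poly f (\<i> * of_real x))"
    using bezout_imaginary_part[OF cop deg f] by metis
  define w where "w x = phasor b \<omega> x" for x
  define v where "v x = phasor h \<omega> x" for x
  have vw: "Im (v x * cnj (w x)) = Re (poly f (\<i> * of_real x))" for x
  proof -
    have "v x * cnj (w x) = poly h (\<i> * of_real x) * cnj (poly b (\<i> * of_real x)) *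
        (cis (\<omega> * x / 2) * cnj (cis (\<omega> * x / 2)))"
      by (simp add: v_def w_def phasor_def)
    then show ?thesis
      using h(2)[of x] by (simp add: cis_cnj cis_mult)
  qed
  define G0 where "G0 x = \<sigma>\<^sup>2 * (cmod (w x))\<^sup>2 - (Im (w x))\<^sup>2" for x
  define G1 where "G1 x = 2 * (\<sigma>\<^sup>2 * Re (v x * cnj (w x)) - Im (w x) * Im (v x))" for x
  define G2 where "G2 x = \<sigma>\<^sup>2 * (cmod (v x))\<^sup>2 - (Im (v x))\<^sup>2" for x
  obtain t where t: "0 < t" "\<And>x. x \<in> {-1..1} \<Longrightarrow> 0 < G0 x + t * G1 x + t\<^sup>2 * G2 x"
  proof (rule positive_perturbation[of "{-1..1}" G0 G1 G2])
    show "continuous_on {- 1..1} G0" "continuous_on {- 1..1} G1" "continuous_on {- 1..1} G2"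
      unfolding G0_def G1_def G2_def w_def v_def phasor_def cis_conv_exp
      by (intro continuous_intros; simp)+
    show "0 \<le> G0 x" if "x \<in> {-1..1}" for x
      using err[OF that] by (simp add: G0_def w_def)
    show "0 < G1 x" if x: "x \<in> {-1..1}" "G0 x = 0" for x
    proof -
      have eq: "\<sigma>\<^sup>2 * (cmod (w x))\<^sup>2 = (Im (w x))\<^sup>2"
        using x(2) by (simp add: G0_def)
      \<comment> \<open>Multiplying by \<open>\<bar>w x\<bar>\<^sup>2\<close> makes \<open>eq\<close> applicable, and only the part of \<open>v\<close> that turns \<open>w\<close> survives.\<close>
      have "(cmod (w x))\<^sup>2 * G1 x =
          2 * ((\<sigma>\<^sup>2 * (cmod (w x))\<^sup>2) * Re (v x * cnj (w x)) - (cmod (w x))\<^sup>2 * (Im (w x) * Im (v x)))"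
        by (simp add: G1_def algebra_simps)
      also have "\<dots> = - 2 * (Re (w x) * Im (w x) * Im (v x * cnj (w x)))"
        unfolding eq unfolding cmod_power2 by (simp add: algebra_simps power2_eq_square)
      also have "\<dots> > 0"
        using sep[OF x(1)] eq unfolding vw by (simp add: w_def ac_simps)
      finally show ?thesis
        by (simp add: zero_less_mult_iff)
    qed
  qed auto
  define q where "q = b + smult (of_real t) h"
  have "degree q \<le> n"
    unfolding q_def using deg h(1) by (intro degree_add_le order.trans[OF degree_smult_le])
  moreover have "(Im (phasor q \<omega> x))\<^sup>2 < \<sigma>\<^sup>2 * (cmod (phasor q \<omega> x))\<^sup>2" if x: "x \<in> {-1..1}" for x
  proof -
    have "phasor q \<omega> x = w x + of_real t * v x"
      by (simp add: phasor_def q_def w_def v_def algebra_simps)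
    then have "\<sigma>\<^sup>2 * (cmod (phasor q \<omega> x))\<^sup>2 - (Im (phasor q \<omega> x))\<^sup>2 = G0 x + t * G1 x + t\<^sup>2 * G2 x"
      unfolding G0_def G1_def G2_def cmod_power2 by (simp add: algebra_simps power2_eq_square)
    with t(2)[OF x] show ?thesis
      by simp
  qed
  ultimately show ?thesis
    using that by blast
qed

text \<open>At such a point, if \<open>b\<close> does not vanish there, \<open>dag b / b\<close> agrees with \<open>exp (\<omega>\<cdot>)\<close>, and its phase, whose
  derivative along the axis is \<open>-2 Re (b'/b)\<close>, grows at rate at least \<open>\<omega>\<close>.\<close>

definition fast_contact :: "complex poly \<Rightarrow> real \<Rightarrow> real \<Rightarrow> bool" where
  "fast_contact b \<omega> x \<longleftrightarrow> Im (phasor b \<omega> x) = 0 \<and>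
    2 * Re (poly (pderiv b) (\<i> * of_real x) * cnj (poly b (\<i> * of_real x))) \<le>
      - \<omega> * (cmod (poly b (\<i> * of_real x)))\<^sup>2"

definition phasor_deriv :: "complex poly \<Rightarrow> real \<Rightarrow> real \<Rightarrow> complex" where
  "phasor_deriv b \<omega> x = \<i> * (poly (pderiv b) (\<i> * of_real x) * cis (\<omega> * x / 2)) +
    \<i> * of_real (\<omega> / 2) * phasor b \<omega> x"

text \<open>The function \<open>- Re W \<cdot> Im W\<close> is \<open>\<bar>W\<bar>\<^sup>2 / 2\<close> times the sine of the phase error, so it
  has the sign of the phase error as long as that error is below \<open>\<pi>\<close>.\<close>

lemma DERIV_Re_Im_phasor:
  "((\<lambda>x. - (Re (phasor b \<omega> x) * Im (phasor b \<omega> x))) has_real_derivative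
    - (Re (phasor_deriv b \<omega> x) * Im (phasor b \<omega> x) + Re (phasor b \<omega> x) * Im (phasor_deriv b \<omega> x))) (at x)"
proof -
  have phasor: "phasor b \<omega> = (\<lambda>x. poly b (\<i> * of_real x) * exp (\<i> * of_real \<omega> * of_real x / 2))"
    by (simp add: phasor_def fun_eq_iff cis_conv_exp mult.assoc)
  have "((\<lambda>z. poly b (\<i> * z)) has_field_derivative poly (pderiv b) (\<i> * of_real x) * \<i>) (at (of_real x))"
    using DERIV_chain2[OF poly_DERIV DERIV_cmult_Id, of b \<i> "of_real x"] .
  moreover have "((\<lambda>z. exp (\<i> * of_real \<omega> * z / 2)) has_field_derivative
      exp (\<i> * of_real \<omega> * of_real x / 2) * (\<i> * of_real \<omega> / 2)) (at (of_real x))"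
    by (auto intro!: derivative_eq_intros)
  ultimately have "((\<lambda>z. poly b (\<i> * z) * exp (\<i> * of_real \<omega> * z / 2)) has_field_derivative
      poly (pderiv b) (\<i> * of_real x) * \<i> * exp (\<i> * of_real \<omega> * of_real x / 2) +
      exp (\<i> * of_real \<omega> * of_real x / 2) * (\<i> * of_real \<omega> / 2) * poly b (\<i> * of_real x)) (at (of_real x))"
    by (rule DERIV_mult)
  then have "(phasor b \<omega> has_vector_derivative phasor_deriv b \<omega> x) (at x)"
    unfolding phasor_deriv_def phasor
    by (intro has_vector_derivative_eq_rhs[OF has_vector_derivative_real_field])
      (auto simp: cis_conv_exp algebra_simps)
  then have "((\<lambda>x. Re (phasor b \<omega> x)) has_real_derivative Re (phasor_deriv b \<omega> x)) (at x)"
    "((\<lambda>x. Im (phasor b \<omega> x)) has_real_derivative Im (phasor_deriv b \<omega> x)) (at x)"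
    unfolding has_real_derivative_iff_has_vector_derivative
    by (simp_all add: bounded_linear.has_vector_derivative bounded_linear_Re bounded_linear_Im)
  from DERIV_minus[OF DERIV_mult[OF this]] show ?thesis
    by (simp add: algebra_simps)
qed

lemma fast_contactI:
  assumes "Im (phasor b \<omega> x) = 0"
    and "((\<lambda>x. - (Re (phasor b \<omega> x) * Im (phasor b \<omega> x))) has_real_derivative V') (at x)" "0 \<le> V'"
  shows "fast_contact b \<omega> x"
proof -
  define c where "c = cis (\<omega> * x / 2)"
  define D where "D = phasor_deriv b \<omega>"
  have "V' = - (Re (D x) * Im (phasor b \<omega> x) + Re (phasor b \<omega> x) * Im (D x))"
    unfolding D_def by (rule DERIV_unique[OF assms(2) DERIV_Re_Im_phasor])
  then have "Re (phasor b \<omega> x) * Im (D x) \<le> 0"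
    using assms(1,3) by simp
  also have "Re (phasor b \<omega> x) * Im (D x) = Im (D x * cnj (phasor b \<omega> x))"
    using assms(1) by simp
  also have "D x * cnj (phasor b \<omega> x) =
      \<i> * (poly (pderiv b) (\<i> * of_real x) * cnj (poly b (\<i> * of_real x)) * (c * cnj c) +
        of_real (\<omega> / 2) * (phasor b \<omega> x * cnj (phasor b \<omega> x)))"
    by (simp add: D_def phasor_deriv_def phasor_def c_def algebra_simps)
  also have "c * cnj c = 1"
    by (simp add: c_def cis_cnj cis_mult)
  also have "phasor b \<omega> x * cnj (phasor b \<omega> x) = of_real ((cmod (poly b (\<i> * of_real x)))\<^sup>2)"
    by (simp only: complex_norm_square [symmetric] norm_phasor)
  finally show ?thesis
    using assms(1) by (simp add: fast_contact_def)
qed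

text \<open>Optimality excludes a separating polynomial of degree at most \<open>n + degree b\<close>, so the phase
  error crosses zero upwards at least \<open>M\<close> times, and each such crossing is a fast contact. An error below \<open>2\<close>
  enters through \<open>Re W \<noteq> 0\<close>: it ensures that a zero of \<open>Re W \<cdot> Im W\<close> is a point of agreement and not one
  of opposite phase. If the error is zero, every interior point is a fast contact.\<close>

lemma best_approx_fast_contacts:
  assumes best: "unitary_best_approx n \<omega> (Fract (dag b) b)"
    and err2: "exp_error (Fract (dag b) b) \<omega> < 2"
    and cop: "coprime b (dag b)" and deg: "degree b \<le> n"
    and nz: "\<And>x. poly b (\<i> * of_real x) \<noteq> 0"
    and M: "2 * M \<le> Suc (n + degree b)"
  obtains X where "finite X" "card X = M" "\<And>x. x \<in> X \<Longrightarrow> fast_contact b \<omega> x"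
proof -
  define r where "r = Fract (dag b) b"
  define \<sigma> where "\<sigma> = exp_error r \<omega> / 2"
  define w where "w x = phasor b \<omega> x" for x
  define V where "V x = - (Re (w x) * Im (w x))" for x
  have w0: "w x \<noteq> 0" for x
    using nz[of x] by (simp add: w_def phasor_def)
  have r: "r \<in> unitary_rats n"
    using best by (simp add: unitary_best_approx_def r_def)
  have bound: "2 * \<bar>Im (w x)\<bar> / cmod (w x) \<le> exp_error r \<omega>" if "x \<in> {-1..1}" for x
    using exp_error_attained[OF r, of \<omega>] that error_eq_phasor[OF nz, of x \<omega>] unfolding r_def w_def by metis
  have err: "\<bar>Im (w x)\<bar> \<le> \<sigma> * cmod (w x)" if "x \<in> {-1..1}" for x
    using bound[OF that] w0[of x] by (simp add: \<sigma>_def pos_divide_le_eq)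
  have \<sigma>: "0 \<le> \<sigma>" "\<sigma> < 1"
  proof -
    have "0 \<le> \<sigma> * cmod (w 0)"
      using err[of 0] abs_ge_zero order_trans by fastforce
    then show "0 \<le> \<sigma>"
      using w0[of 0] by (simp add: zero_le_mult_iff)
    show "\<sigma> < 1"
      using err2 by (simp add: \<sigma>_def r_def)
  qed
  have err': "(Im (w x))\<^sup>2 \<le> \<sigma>\<^sup>2 * (cmod (w x))\<^sup>2" if "x \<in> {-1..1}" for x
    using power_mono[OF err[OF that] abs_ge_zero, of 2] by (simp add: power_mult_distrib)
  have Re0: "Re (w x) \<noteq> 0" if "x \<in> {-1..1}" for x
  proof
    assume "Re (w x) = 0"
    then have "cmod (w x) = \<bar>Im (w x)\<bar>"
      by (simp add: cmod_def)
    moreover have "\<sigma> * cmod (w x) < 1 * cmod (w x)"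
      using \<sigma>(2) w0[of x] by (intro mult_strict_right_mono) auto
    ultimately show False
      using err[OF that] by simp
  qed
  define D where "D = phasor_deriv b \<omega>"
  define V' where "V' x = - (Re (D x) * Im (phasor b \<omega> x) + Re (phasor b \<omega> x) * Im (D x))" for x
  have deriv: "(V has_real_derivative V' x) (at x)" for x
    unfolding V'_def V_def w_def D_def by (rule DERIV_Re_Im_phasor)
  have contact: "fast_contact b \<omega> x" if "V x = 0" "0 \<le> V' x" "x \<in> {-1..1}" for x
  proof (rule fast_contactI)
    show "Im (phasor b \<omega> x) = 0"
      using that Re0[of x] by (simp add: V_def w_def)
  qed (use that(2) deriv[of x] in \<open>simp_all add: V_def [abs_def] w_def [abs_def]\<close>)
  show ?thesis
  proof (cases "\<sigma> = 0")
    case True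
    have V0: "V x = 0" if "x \<in> {-1..1}" for x
      using err[OF that] True by (simp add: V_def)
    have "fast_contact b \<omega> x" if x: "x \<in> {-1<..<1}" for x
    proof -
      have "((\<lambda>_. 0) has_real_derivative V' x) (at x)"
        by (rule has_field_derivative_transform_within_open[OF deriv open_greaterThanLessThan x])
          (auto simp: V0)
      then have "V' x = 0"
        using DERIV_unique DERIV_const by blast
      then show ?thesis
        using contact[of x] V0[of x] x by simp
    qed
    moreover obtain X where "X \<subseteq> {-1<..<1::real}" "finite X" "card X = M"
      using infinite_arbitrarily_large[of "{-1<..<1::real}" M] by auto
    ultimately show ?thesis
      using that by blast
  next
    case False
    define E where "E = {x \<in> {-1..1}. (Im (w x))\<^sup>2 = \<sigma>\<^sup>2 * (cmod (w x))\<^sup>2}"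
    have V_E: "V x \<noteq> 0" if "x \<in> E" for x
      using that Re0[of x] w0[of x] False by (auto simp: E_def V_def)
    define A where "A = {x \<in> E. 0 \<le> V x}"
    define B where "B = {x \<in> E. V x \<le> 0}"
    have "continuous_on UNIV w"
      unfolding w_def phasor_def cis_conv_exp by (intro continuous_intros; simp)
    then have "closed ({-1..1} \<inter> {x. (Im (w x))\<^sup>2 = \<sigma>\<^sup>2 * (cmod (w x))\<^sup>2} \<inter> {x. 0 \<le> V x})"
      "closed ({-1..1} \<inter> {x. (Im (w x))\<^sup>2 = \<sigma>\<^sup>2 * (cmod (w x))\<^sup>2} \<inter> {x. V x \<le> 0})"
      unfolding V_def
      by (intro closed_Int closed_atLeastAtMost closed_Collect_eq closed_Collect_le continuous_intros; assumption)+
    then have closed: "closed A" "closed B"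
      by (simp_all add: A_def B_def E_def Int_def)
    \<comment> \<open>The bound \<open>-2\<close> is any number to the left of \<open>[-1, 1]\<close>.\<close>
    have "(\<exists>X. finite X \<and> card X = M \<and> X \<subseteq> {-2<..} \<and> (\<forall>c\<in>X. fast_contact b \<omega> c)) \<or>
      (\<exists>Y. finite Y \<and> card Y < 2 * M \<and> Y \<subseteq> {-2<..} \<and>
        (\<forall>x\<in>A. 0 < (\<Prod>y\<in>Y. y - x)) \<and> (\<forall>x\<in>B. (\<Prod>y\<in>Y. y - x) < 0))"
    proof (rule crossings_or_separating_product[OF closed])
      show "\<exists>c. x < c \<and> c < y \<and> fast_contact b \<omega> c" if "x \<in> B" "y \<in> A" "x < y" for x y
      proof -
        have "V x < 0" "0 < V y" "x \<in> {-1..1}" "y \<in> {-1..1}"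
          using that V_E[of x] V_E[of y] by (auto simp: A_def B_def E_def)
        then obtain c where "x < c" "c < y" "V c = 0" "0 \<le> V' c"
          using upward_crossing[OF \<open>x < y\<close> _ _ deriv] by metis
        then show ?thesis
          using contact[of c] \<open>x \<in> {-1..1}\<close> \<open>y \<in> {-1..1}\<close> by auto
      qed
    qed (use V_E in \<open>force simp: A_def B_def E_def\<close>)+
    then show ?thesis
    proof (elim disjE exE conjE)
      fix X
      assume "finite X" "card X = M" "\<forall>c\<in>X. fast_contact b \<omega> c"
      then show ?thesis
        using that by blast
    next
      fix Y
      assume Y: "finite Y" "card Y < 2 * M"
        "\<forall>x\<in>A. 0 < (\<Prod>y\<in>Y. y - x)" "\<forall>x\<in>B. (\<Prod>y\<in>Y. y - x) < 0"
      have sep: "Re (phasor b \<omega> x) * Im (phasor b \<omega> x) * Re (poly (axis_prod Y) (\<i> * of_real x)) < 0"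
        if "x \<in> {-1..1}" "(Im (phasor b \<omega> x))\<^sup>2 = \<sigma>\<^sup>2 * (cmod (phasor b \<omega> x))\<^sup>2" for x
      proof -
        have "x \<in> E"
          using that by (simp add: E_def w_def)
        then consider "x \<in> A" "0 < V x" | "x \<in> B" "V x < 0"
          using V_E[of x] by (force simp: A_def B_def)
        then have "0 < V x * (\<Prod>y\<in>Y. y - x)"
          by cases (use Y in \<open>auto simp: zero_less_mult_iff\<close>)
        then show ?thesis
          unfolding poly_axis_prod Re_complex_of_real by (simp add: V_def w_def)
      qed
      have "degree (axis_prod Y) \<le> n + degree b"
        using Y(1,2) M by (simp add: degree_axis_prod)
      then obtain q where q: "degree q \<le> n"
        "\<And>x. x \<in> {-1..1} \<Longrightarrow> (Im (phasor q \<omega> x))\<^sup>2 < \<sigma>\<^sup>2 * (cmod (phasor q \<omega> x))\<^sup>2"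
        using improve_if_separated[OF cop deg, of "axis_prod Y" \<omega> \<sigma>] err'[unfolded w_def] sep
        by metis
      have "Fract (dag q) q \<in> unitary_rats n" "exp_error (Fract (dag q) q) \<omega> < 2 * \<sigma>"
        using exp_error_less[OF q(1) \<sigma>(1) q(2)] by auto
      then show ?thesis
        using best by (force simp: unitary_best_approx_def \<sigma>_def r_def)
    qed
  qed
qed

section \<open>Positivity of the kernel at the contact points\<close>

text \<open>Evaluation at \<open>z\<close> as a combination of the values on \<open>X\<close>: Lagrange interpolation, with the weights left abstract.\<close>

lemma lagrange_functional:
  fixes X :: "'a::field set"
  assumes "finite X" "X \<noteq> {}"
  obtains l where "\<And>p. degree p < card X \<Longrightarrow> poly p z = (\<Sum>x\<in>X. l x * poly p x)"
proof -
  define L where "L x = (\<Prod>y\<in>X - {x}. smult (1 / (x - y)) [:- y, 1:])" for x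
  have deg: "degree (L x) < card X" if "x \<in> X" for x
  proof -
    have "degree (L x) \<le> (\<Sum>y\<in>X - {x}. degree (smult (1 / (x - y)) [:- y, 1:]))"
      unfolding L_def using assms(1) by (intro degree_prod_sum_le[unfolded o_def]) auto
    also have "\<dots> \<le> (\<Sum>y\<in>X - {x}. 1)"
      by (intro sum_mono order.trans[OF degree_smult_le]) simp
    also have "\<dots> = card (X - {x})"
      by simp
    also have "\<dots> < card X"
      using assms(1) that by (rule card_Diff1_less)
    finally show ?thesis .
  qed
  have val: "poly (L x) y = (if x = y then 1 else 0)" if "x \<in> X" "y \<in> X" for x y
  proof (cases "x = y")
    case True
    then show ?thesis
      by (auto simp: L_def poly_prod intro!: prod.neutral simp flip: diff_divide_distrib split: if_splits)
  next
    case False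
    then show ?thesis
      using that assms(1) by (auto simp: L_def poly_prod intro!: bexI[of _ y])
  qed
  have "poly p z = (\<Sum>x\<in>X. poly (L x) z * poly p x)" if p: "degree p < card X" for p
  proof -
    define q where "q = (\<Sum>x\<in>X. smult (poly p x) (L x))"
    have "p = q"
    proof (rule poly_eqI_degree[of X])
      show "poly p y = poly q y" if "y \<in> X" for y
      proof -
        have "poly q y = (\<Sum>x\<in>X. if x = y then poly p x else 0)"
          unfolding q_def poly_sum using val that by (intro sum.cong) auto
        then show ?thesis
          using that assms(1) by simp
      qed
      show "degree q < card X"
        unfolding q_def using assms
        by (intro degree_sum_less le_less_trans[OF degree_smult_le deg]) (auto simp: card_gt_0_iff)
    qed (use p in auto)
    then have "poly p z = poly q z"
      by simp
    then show ?thesis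
      by (simp add: q_def poly_sum mult.commute)
  qed
  then show ?thesis
    by (rule that)
qed

text \<open>The integral of \<open>cos (s d)\<close> over \<open>s \<in> [-t/2, t/2]\<close>. Up to unimodular factors it is the
  kernel \<open>(1 - exp (tu) \<cdot> cnj (exp (tv))) / - (u + cnj v)\<close> at two points of the imaginary axis at distance \<open>d\<close>.\<close>

definition sinc_kernel :: "real \<Rightarrow> real \<Rightarrow> real" where
  "sinc_kernel t d = (if d = 0 then t else 2 * sin (t * d / 2) / d)"

text \<open>The quadratic form vanishes at \<open>t = 0\<close>, and its derivative in \<open>t\<close> is a sum of two squares
  by the addition theorem for the cosine.\<close>

lemma sinc_kernel_psd:
  assumes "finite X" "0 \<le> t"
  shows "0 \<le> (\<Sum>x\<in>X. \<Sum>y\<in>X. \<alpha> x * \<alpha> y * sinc_kernel t (y - x))"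
proof -
  define F where "F t = (\<Sum>x\<in>X. \<Sum>y\<in>X. \<alpha> x * \<alpha> y * sinc_kernel t (y - x))" for t
  have "F 0 \<le> F t"
  proof (rule DERIV_nonneg_imp_nondecreasing[OF assms(2)])
    fix s
    have "((\<lambda>t. sinc_kernel t d) has_real_derivative cos (s * d / 2)) (at s)" for d
      unfolding sinc_kernel_def by (cases "d = 0") (auto intro!: derivative_eq_intros)
    then have "(F has_real_derivative (\<Sum>x\<in>X. \<Sum>y\<in>X. \<alpha> x * \<alpha> y * cos (s * (y - x) / 2))) (at s)"
      unfolding F_def by (intro DERIV_sum DERIV_cmult)
    moreover have "(\<Sum>x\<in>X. \<Sum>y\<in>X. \<alpha> x * \<alpha> y * cos (s * (y - x) / 2)) =
        (\<Sum>x\<in>X. \<alpha> x * cos (s * x / 2))\<^sup>2 + (\<Sum>x\<in>X. \<alpha> x * sin (s * x / 2))\<^sup>2"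
    proof -
      have "\<alpha> x * \<alpha> y * cos (s * (y - x) / 2) =
          (\<alpha> x * cos (s * x / 2)) * (\<alpha> y * cos (s * y / 2)) +
          (\<alpha> x * sin (s * x / 2)) * (\<alpha> y * sin (s * y / 2))" for x y
        by (simp add: right_diff_distrib diff_divide_distrib cos_diff algebra_simps)
      then show ?thesis
        by (simp only: power2_eq_square sum_product sum.distrib)
    qed
    ultimately have "(F has_real_derivative
        (\<Sum>x\<in>X. \<alpha> x * cos (s * x / 2))\<^sup>2 + (\<Sum>x\<in>X. \<alpha> x * sin (s * x / 2))\<^sup>2) (at s)"
      by (simp only:)
    then show "\<exists>y. (F has_real_derivative y) (at s) \<and> 0 \<le> y"
      by (intro exI conjI) (assumption, intro add_nonneg_nonneg zero_le_power2)
  qed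
  moreover have "sinc_kernel 0 d = 0" for d
    by (simp add: sinc_kernel_def)
  then have "F 0 = 0"
    by (simp add: F_def)
  ultimately show ?thesis
    by (simp add: F_def)
qed

text \<open>Consider \<open>K(z, w) = (b(z) cnj(b(w)) - dag b(z) cnj(dag b(w))) / - (z + cnj w)\<close>. The numerator
  vanishes at \<open>z = - cnj w\<close>, so \<open>K\<close> is a polynomial of degree below \<open>degree b\<close> in \<open>z\<close>, and it is Hermitian.
  Its values at the contact points, of which there are at least \<open>degree b\<close>, therefore determine it, and \<open>K(z, z)\<close> is the value of the Hermitian form with
  matrix \<open>K(\<i>x, \<i>y)\<close> at a vector of interpolation weights. Off the diagonal the matrix only sees
  the values of \<open>dag b / b\<close>, so it is, up to scaling by \<open>m x \<cdot> m y\<close>, the positive semidefinite matrix of the exponential. On the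
  diagonal it sees the derivative of the phase, which for fast contacts can only add a nonnegative amount.
  Thus \<open>K(z, z) \<ge> 0\<close>, which is the claim because \<open>- 2 Re z > 0\<close>.\<close>

lemma contacts_imp_dag_le:
  assumes X: "finite X" "X \<noteq> {}" "degree b \<le> card X" and \<omega>: "0 \<le> \<omega>"
    and contact: "\<And>x. x \<in> X \<Longrightarrow> fast_contact b \<omega> x"
    and z: "Re z < 0"
  shows "cmod (poly (dag b) z) \<le> cmod (poly b z)"
proof -
  define N where "N w = smult (cnj (poly b w)) b - smult (cnj (poly (dag b) w)) (dag b)" for w
  have "\<exists>k. N w = [:- cnj w, -1:] * k" for w
  proof -
    have "poly (N w) (- cnj w) = 0"
      by (simp add: N_def poly_dag)
    then have "[:cnj w, 1:] dvd N w"
      using poly_eq_0_iff_dvd[of "N w" "- cnj w"] by simp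
    then obtain k where "N w = [:cnj w, 1:] * k" ..
    then have "N w = [:- cnj w, -1:] * (- k)"
      by simp
    then show ?thesis ..
  qed
  then obtain k where k: "\<And>w. N w = [:- cnj w, -1:] * k w"
    by metis
  have eval: "- (u + cnj w) * poly (k w) u =
      poly b u * cnj (poly b w) - poly (dag b) u * cnj (poly (dag b) w)" for u w
    using arg_cong[OF k[of w], of "\<lambda>p. poly p u"] by (simp add: N_def algebra_simps)
  have deg: "degree (k w) < card X" for w
  proof (cases "k w = 0")
    case True
    then show ?thesis
      using X by (simp add: card_gt_0_iff)
  next
    case False
    have "degree (N w) \<le> degree b"
      unfolding N_def by (intro degree_diff_le order.trans[OF degree_smult_le]) (auto simp: degree_dag)
    moreover have "degree (N w) = 1 + degree (k w)"
      unfolding k[of w] using False by (subst degree_mult_eq) auto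
    ultimately show ?thesis
      using X(3) by simp
  qed
  \<comment> \<open>Interpolation at the points \<open>\<i>x\<close> expresses \<open>K(z, z)\<close> through the values of \<open>K\<close> there.\<close>
  define j where "j = (\<lambda>x. \<i> * complex_of_real x)"
  have inj: "inj_on j X"
    by (auto simp: j_def inj_on_def)
  obtain l0 where "\<And>p. degree p < card (j ` X) \<Longrightarrow> poly p z = (\<Sum>u\<in>j ` X. l0 u * poly p u)"
    using lagrange_functional[of "j ` X" z] X by auto
  then obtain l where l: "\<And>p. degree p < card X \<Longrightarrow> poly p z = (\<Sum>x\<in>X. l x * poly p (j x))"
    using that[of "l0 \<circ> j"] by (simp add: card_image[OF inj] sum.reindex[OF inj])
  define m where "m x = Re (phasor b \<omega> x)" for x
  have b_eq: "poly b (j x) = of_real (m x) * cis (- (\<omega> * x / 2))" if "x \<in> X" for x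
  proof -
    have "of_real (m x) = phasor b \<omega> x"
      using contact[OF that] by (simp add: complex_eq_iff m_def fast_contact_def)
    then have "of_real (m x) * cis (- (\<omega> * x / 2)) = poly b (j x) * (cis (\<omega> * x / 2) * cis (- (\<omega> * x / 2)))"
      by (simp add: phasor_def j_def)
    then show ?thesis
      by (simp add: cis_mult)
  qed
  \<comment> \<open>The surplus of the phase derivative over \<open>\<omega>\<close>, scaled by \<open>(m x)\<^sup>2\<close>.\<close>
  define d where "d x = - 2 * Re (poly (pderiv b) (j x) * cnj (poly b (j x))) - \<omega> * (m x)\<^sup>2" for x
  have d_nonneg: "0 \<le> d x" if "x \<in> X" for x
    using contact[OF that] b_eq[OF that] unfolding fast_contact_def d_def by (simp add: j_def norm_mult)
  have offdiag: "poly (k (j x)) (j y) = of_real (m x * m y * sinc_kernel \<omega> (y - x))"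
    if "x \<in> X" "y \<in> X" "x \<noteq> y" for x y
  proof -
    define \<theta> where "\<theta> = \<omega> * (y - x) / 2"
    have "- (\<i> * of_real (y - x)) * poly (k (j x)) (j y) =
        poly b (j y) * cnj (poly b (j x)) - cnj (poly b (j y)) * poly b (j x)"
      using eval[of "j y" "j x"] by (simp add: j_def poly_dag_imaginary_axis algebra_simps)
    also have "\<dots> = of_real (m x * m y) * (cis (- \<theta>) - cis \<theta>)"
      using that by (simp add: b_eq cis_cnj \<theta>_def cis_mult algebra_simps diff_divide_distrib)
    also have "cis (- \<theta>) - cis \<theta> = - (\<i> * of_real (2 * sin \<theta>))"
      by (simp add: complex_eq_iff)
    also have "2 * sin \<theta> = (y - x) * sinc_kernel \<omega> (y - x)"
      using that by (simp add: sinc_kernel_def \<theta>_def)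
    finally have "- (\<i> * of_real (y - x)) * poly (k (j x)) (j y) =
        - (\<i> * of_real (y - x)) * of_real (m x * m y * sinc_kernel \<omega> (y - x))"
      by (simp only: of_real_mult) (simp add: algebra_simps)
    then show ?thesis
      using that(3) by simp
  qed
  have diag: "poly (k (j x)) (j x) = of_real (m x * m x * sinc_kernel \<omega> 0 + d x)" if "x \<in> X" for x
  proof -
    \<comment> \<open>On the axis \<open>j x = - cnj (j x)\<close>, so the diagonal value comes from the derivative of the numerator.\<close>
    have "poly (pderiv (N (j x))) (j x) = - poly (k (j x)) (j x)"
      unfolding k[of "j x"] pderiv_mult by (simp add: j_def pderiv_pCons)
    moreover have "poly (pderiv (N (j x))) (j x) =
        poly (pderiv b) (j x) * cnj (poly b (j x)) + cnj (poly (pderiv b) (j x) * cnj (poly b (j x)))"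
      by (simp add: N_def pderiv_diff pderiv_smult pderiv_dag j_def poly_dag_imaginary_axis mult.commute)
    ultimately have "- poly (k (j x)) (j x) = of_real (2 * Re (poly (pderiv b) (j x) * cnj (poly b (j x))))"
      by (simp only: complex_add_cnj)
    then have "poly (k (j x)) (j x) = - of_real (2 * Re (poly (pderiv b) (j x) * cnj (poly b (j x))))"
      by (metis minus_minus)
    then show ?thesis
      by (simp add: d_def sinc_kernel_def power2_eq_square)
  qed
  define K where "K x y = m x * m y * sinc_kernel \<omega> (y - x) + (if x = y then d x else 0)" for x y
  have K: "poly (k (j x)) (j y) = of_real (K x y)" if "x \<in> X" "y \<in> X" for x y
    using offdiag[OF that] diag[OF that(1)] by (cases "x = y") (auto simp: K_def)
  have herm: "poly (k z) (j x) = cnj (poly (k (j x)) z)" for x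
  proof -
    have "- (j x + cnj z) * poly (k z) (j x) = cnj (- (z + cnj (j x)) * poly (k (j x)) z)"
      unfolding eval by (simp add: mult.commute)
    also have "\<dots> = - (j x + cnj z) * cnj (poly (k (j x)) z)"
      by (simp add: add.commute)
    finally have "- (j x + cnj z) * poly (k z) (j x) = - (j x + cnj z) * cnj (poly (k (j x)) z)" .
    moreover have "- (j x + cnj z) \<noteq> 0"
      using z by (auto simp: j_def complex_eq_iff)
    ultimately show ?thesis
      by (metis mult_left_cancel)
  qed
  have "poly (k z) z = (\<Sum>x\<in>X. l x * cnj (\<Sum>y\<in>X. l y * of_real (K x y)))"
    unfolding l[OF deg, of z] herm l[OF deg] using K by (intro sum.cong refl) (simp cong: sum.cong)
  then have "Re (poly (k z) z) = (\<Sum>x\<in>X. \<Sum>y\<in>X. Re (l x * cnj (l y)) * K x y)"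
    by (simp add: sum_distrib_left algebra_simps)
  also have "\<dots> = (\<Sum>x\<in>X. \<Sum>y\<in>X. (Re (l x) * m x) * (Re (l y) * m y) * sinc_kernel \<omega> (y - x)) +
      (\<Sum>x\<in>X. \<Sum>y\<in>X. (Im (l x) * m x) * (Im (l y) * m y) * sinc_kernel \<omega> (y - x)) +
      (\<Sum>x\<in>X. \<Sum>y\<in>X. if x = y then ((Re (l x))\<^sup>2 + (Im (l x))\<^sup>2) * d x else 0)"
    unfolding sum.distrib [symmetric]
    by (intro sum.cong refl) (auto simp: K_def algebra_simps power2_eq_square)
  also have "\<dots> \<ge> 0"
    using X(1) \<omega> d_nonneg by (intro add_nonneg_nonneg sinc_kernel_psd sum_nonneg) auto
  finally have "0 \<le> - (2 * Re z) * Re (poly (k z) z)"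
    using z by (simp add: mult_nonpos_nonneg)
  also have "\<dots> = Re (- (z + cnj z) * poly (k z) z)"
    by (simp add: complex_add_cnj)
  also have "\<dots> = (cmod (poly b z))\<^sup>2 - (cmod (poly (dag b) z))\<^sup>2"
    unfolding eval by (simp add: complex_norm_square [symmetric] flip: of_real_diff of_real_power)
  finally have "(cmod (poly (dag b) z))\<^sup>2 \<le> (cmod (poly b z))\<^sup>2"
    by linarith
  then show ?thesis
    by (rule power2_le_imp_le) simp
qed

section \<open>Poles and modulus of the best approximation\<close>

theorem proposition10p2:
  fixes n :: nat and \<omega> :: real and r :: "complex poly fract"
  assumes "n \<ge> 1"
    and "0 < \<omega>" and "\<omega> < (real n + 1) * pi"
    and "unitary_best_approx n \<omega> r"
  shows "(\<forall>s. is_pole (rat_eval r) s \<longrightarrow> Re s > 0) \<and>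
         (\<forall>z. Re z < 0 \<longrightarrow> cmod (rat_eval r z) < 1)"
proof -
  have "r \<in> unitary_rats n"
    using assms(4) by (simp add: unitary_best_approx_def)
  then obtain b where r: "r = Fract (dag b) b" and deg: "degree b \<le> n" and cop: "coprime b (dag b)"
    and axis: "\<And>x. poly b (\<i> * of_real x) \<noteq> 0"
    using unitary_rats_reduced by metis
  obtain u where "u \<in> unitary_rats n" "exp_error u \<omega> < 2"
    using unitary_error_less_2[OF assms(1-3)] by metis
  then have err: "exp_error (Fract (dag b) b) \<omega> < 2"
    using assms(4) unfolding unitary_best_approx_def r by force
  \<comment> \<open>The kernel needs \<open>degree b\<close> contacts; at least one is requested so as to exclude constants.\<close>
  have "2 * max 1 (degree b) \<le> Suc (n + degree b)"
    using assms(1) deg by (auto simp: max_def)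
  then obtain X where X: "finite X" "card X = max 1 (degree b)" "\<And>x. x \<in> X \<Longrightarrow> fast_contact b \<omega> x"
    using best_approx_fast_contacts[OF assms(4)[unfolded r] err cop deg axis] by metis
  have "X \<noteq> {}"
    using X(2) by auto
  then obtain x where "fast_contact b \<omega> x"
    using X(3) by blast
  have nonconst: "degree b \<noteq> 0"
  proof
    assume "degree b = 0"
    then have "0 \<le> - \<omega> * (cmod (poly b (\<i> * of_real x)))\<^sup>2"
      using \<open>fast_contact b \<omega> x\<close> by (simp add: fast_contact_def pderiv_eq_0_iff[THEN iffD2])
    moreover have "0 < \<omega> * (cmod (poly b (\<i> * of_real x)))\<^sup>2"
      using assms(2) axis by simp
    ultimately show False
      by simp
  qed
  have le: "cmod (poly (dag b) z) \<le> cmod (poly b z)" if "Re z < 0" for z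
    using contacts_imp_dag_le[OF X(1) \<open>X \<noteq> {}\<close> _ _ X(3) that] assms(2) X(2) by simp
  have left: "poly b z \<noteq> 0" if "Re z < 0" for z
    using le[OF that] coprime_poly_0[OF cop, of z] by auto
  have nz: "poly b z \<noteq> 0" if "Re z \<le> 0" for z
  proof (cases "Re z = 0")
    case True
    then have "z = \<i> * of_real (Im z)"
      by (simp add: complex_eq_iff)
    then show ?thesis
      using axis by metis
  qed (use left that in simp)
  have eval: "rat_eval r z = poly (dag b) z / poly b z" if "poly b z \<noteq> 0" for z
    unfolding r using that by (rule rat_eval_Fract)
  have "0 < Re s" if pole: "is_pole (rat_eval r) s" for s
  proof (rule ccontr)
    assume "\<not> 0 < Re s"
    then have "poly b s \<noteq> 0"
      using nz by simp
    then have cont: "isCont (\<lambda>z. poly (dag b) z / poly b z) s"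
      by (intro continuous_intros)
    have ev: "eventually (\<lambda>z. rat_eval r z = poly (dag b) z / poly b z) (nhds s)"
    proof -
      have "open {z. poly b z \<noteq> 0}"
        by (intro open_Collect_neq continuous_intros)
      then have "eventually (\<lambda>z. z \<in> {z. poly b z \<noteq> 0}) (nhds s)"
        using \<open>poly b s \<noteq> 0\<close> by (intro eventually_nhds_in_open) auto
      then show ?thesis
        by eventually_elim (simp add: eval)
    qed
    have "isCont (rat_eval r) s"
      using isCont_cong[OF ev] cont by simp
    then show False
      using pole not_tendsto_and_filterlim_at_infinity[OF trivial_limit_at]
      unfolding isCont_def is_pole_def by blast
  qed
  moreover have "cmod (rat_eval r z) < 1" if z: "Re z < 0" for z
  proof -
    define f where "f z = poly (dag b) z / poly b z" for z
    define H where "H = {z. Re z < 0}"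
    have f_le: "cmod (f w) \<le> 1" if "w \<in> H" for w
      using le[of w] that left[of w] by (simp add: f_def H_def norm_divide)
    have "cmod (f z) \<noteq> 1"
    proof
      assume "cmod (f z) = 1"
      have H: "open H" "connected H" "z \<in> H"
        using z by (auto simp: H_def open_halfspace_Re_lt convex_connected convex_halfspace_Re_lt)
      moreover have "f holomorphic_on H"
        unfolding f_def using left by (intro holomorphic_intros) (auto simp: H_def)
      ultimately have "f constant_on H"
        using f_le \<open>cmod (f z) = 1\<close> by (intro maximum_modulus_principle[of f H H z]) auto
      then obtain c where c: "\<And>w. w \<in> H \<Longrightarrow> f w = c"
        by (auto simp: constant_on_def)
      have "infinite H"
        using H interior_limit_point islimpt_finite interior_open by metis
      moreover have "H \<subseteq> {w. poly (dag b - smult c b) w = 0}"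
        using c left by (auto simp: H_def f_def field_simps)
      ultimately have "dag b - smult c b = 0"
        using poly_roots_finite finite_subset by metis
      then have "b dvd dag b"
        by (simp add: dvd_smult)
      then have "is_unit b"
        using cop by (metis coprime_common_divisor dvd_refl)
      moreover have "b \<noteq> 0"
        using nonconst by auto
      ultimately have "degree b = 0"
        by (rule is_unit_iff_degree [THEN iffD1, rotated])
      with nonconst show False ..
    qed
    moreover have "cmod (f z) \<le> 1"
      using f_le z by (simp add: H_def)
    ultimately have "cmod (f z) < 1"
      by linarith
    then show ?thesis
      using eval[OF left[OF z]] by (simp add: f_def)
  qed
  ultimately show ?thesis
    by blast
qed

end
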